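(* Let $m\ge 0$ and $n\ge 1$ be integers. The number $|\mathcal{R}(m,n)|$ of acyclic orientations of the complete bipartite graph $K_{m,n}$ having no sink in the part $L$ of size $m$ equals \[ n!\,n^m-\sum_{j=1}^{n-1}(-1)^{j-1}\,(n-j)!\,(n-j)^m\left\{ {n \atop n-j} \right\}, \] where $\left\{ {a \atop b} \right\}$ is the Stirling number of the second kind.
   Context: $K_{m,n}$ has vertex set $L\cup R$ with $L=\{1,\dots,m\}$, $R=\{m+1,\dots,m+n\}$, and edges all pairs $\{u,v\}$ with $u\in L$, $v\in R$. An acyclic orientation directs every edge so that there is no directed cycle; a sink is a vertex with no outgoing edge. $\mathcal{R}(m,n)$ is the set of acyclic orientations of $K_{m,n}$ in which no vertex of $L$ is a sink. *)

theory Defs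
  imports "HOL-Combinatorics.Stirling"
begin

type_synonym 'a edges = "'a set set"

(* An undirected edge is the two-element set of its endpoints; an arc (u, v) points from u to v.
   The bijection says that every arc directs an edge of the graph and that every edge
   carries exactly one of its two directions. *)
definition is_orientation :: "'a edges \<Rightarrow> 'a rel \<Rightarrow> bool" where
  "is_orientation E D \<longleftrightarrow> bij_betw (\<lambda>(u, v). {u, v}) D E"

definition is_sink :: "'a rel \<Rightarrow> 'a \<Rightarrow> bool" where
  "is_sink D v \<longleftrightarrow> (\<nexists>w. (v, w) \<in> D)"

definition left_part :: "nat \<Rightarrow> nat set" where
  "left_part m = {1..m}"

definition right_part :: "nat \<Rightarrow> nat \<Rightarrow> nat set" where
  "right_part m n = {m + 1..m + n}"

definition bipartite_edges :: "nat \<Rightarrow> nat \<Rightarrow> nat edges" where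
  "bipartite_edges m n = {{u, v} | u v. u \<in> left_part m \<and> v \<in> right_part m n}"

definition R_orientations :: "nat \<Rightarrow> nat \<Rightarrow> nat rel set" where
  "R_orientations m n =
     {D. is_orientation (bipartite_edges m n) D \<and> acyclic D \<and> (\<forall>v \<in> left_part m. \<not> is_sink D v)}"

lemma finite_R_orientations: "finite (R_orientations m n)"
proof (rule finite_subset)
  let ?V = "{1..m + n}"
  show "R_orientations m n \<subseteq> Pow (?V \<times> ?V)"
  proof (intro subsetI PowI)
    fix D p assume D: "D \<in> R_orientations m n" and p: "p \<in> D"
    obtain u v where uv: "p = (u, v)" by (cases p)
    have "{u, v} \<in> bipartite_edges m n"
      using D p uv by (auto simp: R_orientations_def is_orientation_def bij_betw_def)
    then have "{u, v} \<subseteq> ?V"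
      by (auto simp: bipartite_edges_def left_part_def right_part_def doubleton_eq_iff)
    then show "p \<in> ?V \<times> ?V" using uv by simp
  qed
qed simp

end

(* Record an orientation by the out-neighbourhoods N(u) of the vertices u of L. It is acyclic iff
   these sets form a chain under inclusion, and no vertex of L is a sink iff none of them is empty.
   Let f(m, n) be the number of such families. Removing the least set K of the chain from all the
   others and discarding the vertices u with N(u) = K gives, for m > 0,
     f(m, n) = sum over i < m, p < n of (m choose i) (n choose p) f(i, p),   f(0, n) = 1.
   With (S g)(k) = (k + 1) g(k + 1) and (E g)(k) = (S g)(k) - k g(k), the Stirling recurrence turns
   the alternating sum into (E^n g)(0) for g(k) = k^m. This satisfies the same recurrence: for
   h(k) = k^(m - 1), the binomial theorem gives (E h)(k) = sum over i < m of (m choose i) k^i, and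
     sum over p <= n of (n choose p) E^p E h = (1 + E)^n E h   agrees at 0 with   E^n S h
   by induction on n, using S (1 + E) = E S. *)
theory Submission
  imports Defs
begin

section \<open>The operator E, iterated and evaluated at 0, and its Stirling expansion\<close>

fun iterated_diff :: "nat \<Rightarrow> (nat \<Rightarrow> int) \<Rightarrow> int" where
  "iterated_diff 0 f = f 0"
| "iterated_diff (Suc n) f = iterated_diff n (\<lambda>k. int (Suc k) * f (Suc k) - int k * f k)"

lemma iterated_diff_eq_sum_Stirling:
  "iterated_diff n f = (\<Sum>k\<le>n. (- 1) ^ (n + k) * fact k * int (Stirling n k) * f k)"
proof (induction n arbitrary: f)
  case (Suc n)
  define g where "g k = (- 1) ^ (n + k) * fact k * int k * int (Stirling n k) * f k" for k
  let ?c = "\<lambda>k. (- 1) ^ (n + k) * fact k * int (Stirling n k)"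
  \<comment> \<open>Shifting the index costs nothing: \<open>g 0 = 0\<close> by the factor
    \<open>k\<close>, and \<open>g (Suc n) = 0\<close> since \<open>Stirling n (Suc n) = 0\<close>.
    Afterwards both terms carry \<open>f (Suc k)\<close> and merge by the Stirling
    recurrence.\<close>
  have g: "(\<Sum>k\<le>n. g (Suc k)) = (\<Sum>k\<le>n. g k)"
    using sum.atMost_Suc_shift[of g n] sum.atMost_Suc[of g n] by (simp add: g_def)
  have "iterated_diff (Suc n) f = (\<Sum>k\<le>n. ?c k * (int (Suc k) * f (Suc k)) - g k)"
    unfolding iterated_diff.simps Suc.IH by (intro sum.cong) (auto simp: g_def algebra_simps)
  also have "\<dots> = (\<Sum>k\<le>n. ?c k * (int (Suc k) * f (Suc k)) - g (Suc k))"
    by (simp only: sum_subtractf g)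
  also have "\<dots> = (\<Sum>k\<le>Suc n. (- 1) ^ (Suc n + k) * fact k * int (Stirling (Suc n) k) * f k)"
    by (subst sum.atMost_Suc_shift) (simp add: g_def algebra_simps)
  finally show ?case .
qed simp

lemma iterated_diff_add:
  "iterated_diff n (\<lambda>k. f k + g k) = iterated_diff n f + iterated_diff n g"
  by (simp add: iterated_diff_eq_sum_Stirling distrib_left sum.distrib)

lemma iterated_diff_sum:
  "iterated_diff n (\<lambda>k. \<Sum>i\<in>A. c i * f i k) = (\<Sum>i\<in>A. c i * iterated_diff n (f i))"
  unfolding iterated_diff_eq_sum_Stirling sum_distrib_left
  by (subst sum.swap) (simp add: mult_ac)

text \<open>E fixes the constant 1, as (k + 1) - k = 1. This is the base case f(0, n) = 1 of the
  count.\<close>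

lemma iterated_diff_one: "iterated_diff n (\<lambda>k. 1) = 1"
  by (induction n) simp_all

text \<open>Pascal's rule. With \<open>a p\<close> the value of E^p at 0, it peels one factor off (1
  + E)^(n + 1).\<close>

lemma sum_binomial_Suc:
  fixes a :: "nat \<Rightarrow> int"
  shows "(\<Sum>p\<le>Suc n. int (Suc n choose p) * a p) = (\<Sum>p\<le>n. int (n choose p) * (a p + a (Suc p)))"
proof -
  have "(\<Sum>p\<le>n. int (n choose p) * a p) = a 0 + (\<Sum>p\<le>n. int (n choose Suc p) * a (Suc p))"
    using sum.atMost_Suc_shift[of "\<lambda>p. int (n choose p) * a p" n]
    by (simp add: binomial_eq_0)
  then show ?thesis
    by (subst sum.atMost_Suc_shift) (simp add: algebra_simps sum.distrib)
qed

text \<open>The identity depends on evaluating at 0: already for n = 0 the functions E f and S f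
  differ by \<open>k * f k\<close>.\<close>

lemma binomial_sum_iterated_diff:
  "(\<Sum>p\<le>n. int (n choose p) * iterated_diff p (\<lambda>k. int (Suc k) * f (Suc k) - int k * f k))
    = iterated_diff n (\<lambda>k. int (Suc k) * f (Suc k))"
proof (induction n arbitrary: f)
  case (Suc n)
  let ?D = "\<lambda>f k. int (Suc k) * f (Suc k) - int k * f k"
  have "(\<Sum>p\<le>Suc n. int (Suc n choose p) * iterated_diff p (?D f))
      = (\<Sum>p\<le>n. int (n choose p) * iterated_diff p (\<lambda>k. ?D f k + ?D (?D f) k))"
    by (simp only: sum_binomial_Suc iterated_diff.simps iterated_diff_add)
  also have "\<dots> = (\<Sum>p\<le>n. int (n choose p) * iterated_diff p (?D (\<lambda>k. f k + ?D f k)))"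
    by (simp add: algebra_simps)
  \<comment> \<open>The induction hypothesis is taken at f + E f in place of f.\<close>
  also have "\<dots> = iterated_diff n (\<lambda>k. int (Suc k) * (f (Suc k) + ?D f (Suc k)))"
    by (rule Suc.IH)
  \<comment> \<open>Here S (1 + E) = E S holds pointwise: the summand f changes the coefficient -(k
    + 1) of \<open>f (Suc k)\<close> inside the bracket into -k.\<close>
  also have "\<dots> = iterated_diff (Suc n) (\<lambda>k. int (Suc k) * f (Suc k))"
    by (simp add: algebra_simps)
  finally show ?case .
qed simp

lemma sum_lessThan_binomial:
  fixes a :: "nat \<Rightarrow> int"
  shows "(\<Sum>p<n. int (n choose p) * a p) = (\<Sum>p\<le>n. int (n choose p) * a p) - a n"
  by (simp flip: lessThan_Suc_atMost)

lemma iterated_diff_power_rec: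
  assumes "m > 0"
  shows "iterated_diff n (\<lambda>k. int k ^ m) =
    (\<Sum>i<m. int (m choose i) * (\<Sum>p<n. int (n choose p) * iterated_diff p (\<lambda>k. int k ^ i)))"
proof -
  obtain l where m: "m = Suc l" using assms gr0_implies_Suc by blast
  have "(\<Sum>i<m. int (m choose i) * (\<Sum>p<n. int (n choose p) * iterated_diff p (\<lambda>k. int k ^ i)))
      = (\<Sum>p<n. int (n choose p) * (\<Sum>i<m. int (m choose i) * iterated_diff p (\<lambda>k. int k ^ i)))"
    unfolding sum_distrib_left by (subst sum.swap) (simp add: mult_ac)
  also have "\<dots> = (\<Sum>p<n. int (n choose p) * iterated_diff p (\<lambda>k. int (Suc k) ^ m - int k ^ m))"
  proof -
    have "(\<Sum>i<m. int (m choose i) * int k ^ i) = int (Suc k) ^ m - int k ^ m" for k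
      using binomial_ring[of "int k" 1 m] by (simp add: sum_lessThan_binomial add.commute)
    then show ?thesis by (simp flip: iterated_diff_sum)
  qed
  \<comment> \<open>For h(k) = k^l the functions S h and E h are (k + 1)^m and (k + 1)^m - k^m. The
    subtracted value is the missing term p = n.\<close>
  also have "\<dots> = iterated_diff n (\<lambda>k. int (Suc k) ^ m) - iterated_diff n (\<lambda>k. int (Suc k) ^ m - int k ^ m)"
    using binomial_sum_iterated_diff[where f = "\<lambda>k. int k ^ l" and n = n]
    by (simp only: sum_lessThan_binomial m power_Suc)
  also have "\<dots> = iterated_diff n (\<lambda>k. int k ^ m)"
    using iterated_diff_add[of n "\<lambda>k. int (Suc k) ^ m - int k ^ m" "\<lambda>k. int k ^ m"] by simp
  finally show ?thesis ..
qed

section \<open>Chains of nonempty out-neighbourhoods, counted by removing the least one\<close>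

definition chain_rels :: "'a set \<Rightarrow> 'b set \<Rightarrow> ('a \<times> 'b) set set" where
  "chain_rels A B = {X. X \<subseteq> A \<times> B \<and> (\<forall>u\<in>A. X `` {u} \<noteq> {}) \<and>
     (\<forall>u\<in>A. \<forall>v\<in>A. X `` {u} \<subseteq> X `` {v} \<or> X `` {v} \<subseteq> X `` {u})}"

lemma finite_chain_rels: "finite A \<Longrightarrow> finite B \<Longrightarrow> finite (chain_rels A B)"
  by (rule finite_subset[of _ "Pow (A \<times> B)"]) (auto simp: chain_rels_def)

lemma chain_rels_empty: "chain_rels {} B = {{}}"
  by (auto simp: chain_rels_def)

text \<open>B - B' is the least set K of the chain and A' collects the vertices whose set is larger.
  A' is proper because K is attained, B' because K is nonempty.\<close>

lemma chain_rels_decompose: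
  assumes "finite A" "A \<noteq> {}"
  shows "bij_betw (\<lambda>((A', B'), Y). Y \<union> A \<times> (B - B'))
    (SIGMA (A', B') : (Pow A - {A}) \<times> (Pow B - {B}). chain_rels A' B') (chain_rels A B)"
    (is "bij_betw ?f ?S _")
proof -
  define K where "K X = (\<Inter>u\<in>A. X `` {u})" for X :: "('a \<times> 'b) set"
  define g where "g X = ((Domain (X - A \<times> K X), B - K X), X - A \<times> K X)" for X
  have gf: "g (?f s) = s \<and> ?f s \<in> chain_rels A B" if "s \<in> ?S" for s
  proof -
    obtain A' B' Y where s: "s = ((A', B'), Y)" by (metis surj_pair)
    with that have A': "A' \<subset> A" and B': "B' \<subset> B" and Y: "Y \<in> chain_rels A' B'" by auto
    define X where "X = Y \<union> A \<times> (B - B')"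
    have YA: "Y \<subseteq> A' \<times> B'" using Y by (simp add: chain_rels_def)
    have rows: "X `` {u} = Y `` {u} \<union> (B - B')" if "u \<in> A" for u
      using that by (auto simp: X_def)
    have "K X = B - B'"
    proof
      \<comment> \<open>Such a vertex has no pairs in \<open>Y\<close>, so its set is exactly B -
        B'.\<close>
      obtain u where "u \<in> A" "u \<notin> A'" using A' by blast
      then show "K X \<subseteq> B - B'" using rows[of u] YA by (auto simp: K_def)
    qed (use rows in \<open>auto simp: K_def\<close>)
    moreover have "X - A \<times> (B - B') = Y" using YA A' by (auto simp: X_def)
    moreover have "Domain Y = A'" using Y by (fastforce simp: chain_rels_def)
    ultimately have "g X = s" using B' by (auto simp: g_def s)
    moreover have "X \<in> chain_rels A B"
    proof -
      have "X `` {u} \<subseteq> X `` {v} \<or> X `` {v} \<subseteq> X `` {u}" if uv: "u \<in> A" "v \<in> A" for u v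
      proof (cases "u \<in> A' \<and> v \<in> A'")
        case True
        then have "Y `` {u} \<subseteq> Y `` {v} \<or> Y `` {v} \<subseteq> Y `` {u}"
          using Y by (simp add: chain_rels_def)
        then show ?thesis unfolding rows[OF uv(1)] rows[OF uv(2)] by blast
      next
        case False
        \<comment> \<open>One of the two sets in \<open>X\<close> is then B - B', which every other
          one contains.\<close>
        then have "Y `` {u} = {} \<or> Y `` {v} = {}" using YA by blast
        then show ?thesis unfolding rows[OF uv(1)] rows[OF uv(2)] by blast
      qed
      moreover have "X `` {u} \<noteq> {}" if "u \<in> A" for u using rows[OF that] B' by blast
      moreover have "X \<subseteq> A \<times> B" using YA A' B' by (auto simp: X_def)
      ultimately show ?thesis unfolding chain_rels_def by blast
    qed
    ultimately show ?thesis by (simp add: s X_def)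
  qed
  have fg: "?f (g X) = X \<and> g X \<in> ?S" if X: "X \<in> chain_rels A B" for X
  proof -
    have XA: "X \<subseteq> A \<times> B" and ne: "\<And>u. u \<in> A \<Longrightarrow> X `` {u} \<noteq> {}"
      and ch: "\<And>u v. u \<in> A \<Longrightarrow> v \<in> A \<Longrightarrow> X `` {u} \<subseteq> X `` {v} \<or> X `` {v} \<subseteq> X `` {u}"
      using X by (auto simp: chain_rels_def)
    \<comment> \<open>A minimal set exists by finiteness; comparability makes it least, so it equals
      the intersection \<open>K X\<close>.\<close>
    obtain w where w: "w \<in> A" "\<And>u. u \<in> A \<Longrightarrow> \<not> X `` {u} \<subset> X `` {w}"
      using finite_has_minimal[of "(\<lambda>u. X `` {u}) ` A"] assms
      by (smt (verit, best) empty_is_image finite_imageI image_iff psubsetE)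
    then have Kw: "K X = X `` {w}"
      using ch[OF w(1)] by (fastforce simp: K_def)
    have KA: "A \<times> K X \<subseteq> X" by (auto simp: K_def)
    have KB: "K X \<subseteq> B" "K X \<noteq> {}" using Kw XA ne[OF w(1)] by auto
    have rows: "(X - A \<times> K X) `` {u} = X `` {u} - K X" if "u \<in> A" for u
      using that by auto
    have "w \<notin> Domain (X - A \<times> K X)" using rows[OF w(1)] Kw by blast
    then have "Domain (X - A \<times> K X) \<subset> A" using XA w(1) by blast
    moreover have "B - K X \<subset> B" using KB by blast
    moreover have "X - A \<times> K X \<in> chain_rels (Domain (X - A \<times> K X)) (B - K X)"
    proof -
      let ?Y = "X - A \<times> K X"
      have "?Y `` {u} \<subseteq> ?Y `` {v} \<or> ?Y `` {v} \<subseteq> ?Y `` {u}"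
        if "u \<in> Domain ?Y" "v \<in> Domain ?Y" for u v
      proof -
        have uv: "u \<in> A" "v \<in> A" using that XA by auto
        show ?thesis unfolding rows[OF uv(1)] rows[OF uv(2)] using ch[OF uv] by blast
      qed
      moreover have "?Y \<subseteq> Domain ?Y \<times> (B - K X)" using XA by auto
      moreover have "\<forall>u\<in>Domain ?Y. ?Y `` {u} \<noteq> {}" by blast
      ultimately show ?thesis unfolding chain_rels_def by blast
    qed
    moreover have "?f (g X) = X" using KA KB by (auto simp: g_def)
    ultimately show ?thesis by (auto simp: g_def)
  qed
  show ?thesis
  proof (rule bij_betw_byWitness[where f' = g])
    show "\<forall>s\<in>?S. g (?f s) = s" by (intro ballI conjunct1[OF gf])
    show "\<forall>X\<in>chain_rels A B. ?f (g X) = X" by (intro ballI conjunct1[OF fg])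
    show "?f ` ?S \<subseteq> chain_rels A B" by (intro image_subsetI conjunct2[OF gf])
    show "g ` chain_rels A B \<subseteq> ?S" by (intro image_subsetI conjunct2[OF fg])
  qed
qed

lemma sum_proper_subsets:
  fixes a :: "nat \<Rightarrow> int"
  assumes "finite A"
  shows "(\<Sum>X\<in>Pow A - {A}. a (card X)) = (\<Sum>i<card A. int (card A choose i) * a i)"
proof -
  have "(\<Sum>X\<in>Pow A - {A}. a (card X))
      = (\<Sum>i<card A. \<Sum>X | X \<in> Pow A - {A} \<and> card X = i. a (card X))"
    by (rule sum.group[symmetric]) (use assms psubset_card_mono in auto)
  also have "\<dots> = (\<Sum>i<card A. \<Sum>X | X \<subseteq> A \<and> card X = i. a i)"
    by (intro sum.cong) auto
  finally show ?thesis using assms by (simp add: n_subsets)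
qed

text \<open>Both sides obey the same recurrence. Induction on the size of A suffices, since A' is
  always proper; B stays arbitrary.\<close>

lemma card_chain_rels:
  assumes "finite A" "finite B"
  shows "int (card (chain_rels A B)) = iterated_diff (card B) (\<lambda>k. int k ^ card A)"
  using assms
proof (induction "card A" arbitrary: A B rule: less_induct)
  case less
  show ?case
  proof (cases "A = {}")
    case True
    then show ?thesis by (simp add: chain_rels_empty iterated_diff_one)
  next
    case False
    let ?P = "\<lambda>A. Pow A - {A}"
    have "card (chain_rels A B) = (\<Sum>(A', B')\<in>?P A \<times> ?P B. card (chain_rels A' B'))"
      unfolding bij_betw_same_card[OF chain_rels_decompose[OF less.prems(1) False], symmetric]
      by (subst card_SigmaI)
        (use less.prems in \<open>auto simp: case_prod_beta intro!: finite_chain_rels intro: finite_subset\<close>)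
    then have "int (card (chain_rels A B)) =
        (\<Sum>A'\<in>?P A. \<Sum>B'\<in>?P B. int (card (chain_rels A' B')))"
      by (simp add: sum.cartesian_product case_prod_beta)
    also have "\<dots> = (\<Sum>A'\<in>?P A. \<Sum>B'\<in>?P B. iterated_diff (card B') (\<lambda>k. int k ^ card A'))"
      by (intro sum.cong refl less.hyps)
        (use less.prems in \<open>auto intro: psubset_card_mono finite_subset\<close>)
    also have "\<dots> = (\<Sum>i<card A. int (card A choose i) *
        (\<Sum>B'\<in>?P B. iterated_diff (card B') (\<lambda>k. int k ^ i)))"
      by (rule sum_proper_subsets[OF less.prems(1)])
    also have "\<dots> = (\<Sum>i<card A. int (card A choose i) *
        (\<Sum>p<card B. int (card B choose p) * iterated_diff p (\<lambda>k. int k ^ i)))"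
      by (intro sum.cong refl arg_cong2[where f = "(*)"] sum_proper_subsets[OF less.prems(2)])
    also have "\<dots> = iterated_diff (card B) (\<lambda>k. int k ^ card A)"
      using False less.prems by (intro iterated_diff_power_rec[symmetric]) (simp add: card_gt_0_iff)
    finally show ?thesis .
  qed
qed

section \<open>Orientations encoded by their arcs from A to B; acyclicity as the chain
  condition\<close>

definition orient :: "'a set \<Rightarrow> 'a set \<Rightarrow> 'a rel \<Rightarrow> 'a rel" where
  "orient A B X = X \<union> (A \<times> B - X)\<inverse>"

lemma is_orientation_iff_orient:
  assumes "A \<inter> B = {}"
  shows "is_orientation {{u, v} | u v. u \<in> A \<and> v \<in> B} D \<longleftrightarrow> (\<exists>X \<subseteq> A \<times> B. D = orient A B X)"
proof
  assume D: "is_orientation {{u, v} | u v. u \<in> A \<and> v \<in> B} D"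
  let ?h = "\<lambda>(u, v). {u, v}"
  have inj: "inj_on ?h D" and im: "?h ` D = {{u, v} | u v. u \<in> A \<and> v \<in> B}"
    using D by (auto simp: is_orientation_def bij_betw_def)
  have sub: "u \<in> A \<and> v \<in> B \<or> u \<in> B \<and> v \<in> A" if "(u, v) \<in> D" for u v
  proof -
    have "{u, v} \<in> ?h ` D" using that by force
    then show ?thesis unfolding im by (auto simp: doubleton_eq_iff)
  qed
  have total: "(u, v) \<in> D \<or> (v, u) \<in> D" if "u \<in> A" "v \<in> B" for u v
  proof -
    have "{u, v} \<in> ?h ` D" unfolding im using that by blast
    then show ?thesis by (auto simp: doubleton_eq_iff)
  qed
  \<comment> \<open>Opposite arcs would carry the same edge, and they are distinct because A and B
    are disjoint.\<close>
  have anti: "\<not> ((u, v) \<in> D \<and> (v, u) \<in> D)" if "u \<in> A" "v \<in> B" for u v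
    using inj_onD[OF inj, of "(u, v)" "(v, u)"] that assms by (auto simp: insert_commute)
  have "D = orient A B (D \<inter> A \<times> B)"
    using sub total anti by (auto simp: orient_def)
  then show "\<exists>X \<subseteq> A \<times> B. D = orient A B X" by blast
next
  assume "\<exists>X \<subseteq> A \<times> B. D = orient A B X"
  then obtain X where X: "X \<subseteq> A \<times> B" and D: "D = orient A B X" by blast
  have "inj_on (\<lambda>(u, v). {u, v}) D"
    using assms X by (auto simp: inj_on_def D orient_def doubleton_eq_iff) blast+
  moreover have "(\<lambda>(u, v). {u, v}) ` D = {{u, v} | u v. u \<in> A \<and> v \<in> B}"
  proof (intro equalityI subsetI)
    fix e assume "e \<in> {{u, v} | u v. u \<in> A \<and> v \<in> B}"
    then obtain u v where e: "e = {u, v}" "u \<in> A" "v \<in> B" by blast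
    then have "(u, v) \<in> D \<or> (v, u) \<in> D" by (auto simp: D orient_def)
    then show "e \<in> (\<lambda>(u, v). {u, v}) ` D"
      using e by (auto simp: image_iff insert_commute split: prod.splits intro: bexI[of _ "(u, v)"] bexI[of _ "(v, u)"])
  qed (use X in \<open>fastforce simp: D orient_def insert_commute\<close>)
  ultimately show "is_orientation {{u, v} | u v. u \<in> A \<and> v \<in> B} D"
    by (simp add: is_orientation_def bij_betw_def)
qed

lemma acyclic_orient_iff:
  assumes "A \<inter> B = {}" "finite A" "finite B" and X: "X \<subseteq> A \<times> B"
  shows "acyclic (orient A B X) \<longleftrightarrow>
    (\<forall>u\<in>A. \<forall>v\<in>A. X `` {u} \<subseteq> X `` {v} \<or> X `` {v} \<subseteq> X `` {u})" (is "_ \<longleftrightarrow> ?chain")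
proof
  let ?D = "orient A B X"
  assume acyc: "acyclic ?D"
  show ?chain
  proof (intro ballI, rule ccontr)
    fix u v
    assume uv: "u \<in> A" "v \<in> A" and "\<not> (X `` {u} \<subseteq> X `` {v} \<or> X `` {v} \<subseteq> X `` {u})"
    then obtain x y where "(u, x) \<in> X" "(v, x) \<notin> X" "(v, y) \<in> X" "(u, y) \<notin> X" by blast
    \<comment> \<open>Two incomparable neighbourhoods give the directed 4-cycle u, x, v, y.\<close>
    then have "(u, x) \<in> ?D" "(x, v) \<in> ?D" "(v, y) \<in> ?D" "(y, u) \<in> ?D"
      using uv X by (auto simp: orient_def)
    then have "(u, u) \<in> ?D\<^sup>+" by (meson trancl.simps)
    then show False using acyc by (simp add: acyclic_def)
  qed
next
  assume chain: ?chain
  \<comment> \<open>\<open>below x\<close> is the union of the neighbourhoods that miss x. The rank,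
    even on A and odd off A, strictly decreases along every arc; the parity gives strictness where
    the cardinalities may agree.\<close>
  define below where "below x = \<Union> {X `` {u} | u. u \<in> A \<and> (u, x) \<notin> X}" for x
  define rank where
    "rank x = (if x \<in> A then 2 * card (X `` {x}) else Suc (2 * card (below x)))" for x
  have fin: "finite (X `` {u})" "finite (below x)" for u x
    by (rule finite_subset[of _ B]; use X assms(3) in \<open>auto simp: below_def\<close>)+
  have "(y, x) \<in> measure rank" if "(x, y) \<in> orient A B X" for x y
  proof (cases "(x, y) \<in> X")
    case True
    then have xy: "x \<in> A" "y \<in> B" "y \<notin> A" using X assms(1) by auto
    \<comment> \<open>A neighbourhood missing y cannot contain that of x, so by the chain condition
      it lies inside it.\<close>
    have "below y \<subseteq> X `` {x}"
      using chain xy(1) True unfolding below_def by blast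
    moreover have "y \<notin> below y" by (auto simp: below_def)
    ultimately have "below y \<subset> X `` {x}" using True by blast
    then have "card (below y) < card (X `` {x})" by (simp add: fin psubset_card_mono)
    then show ?thesis using xy by (simp add: rank_def)
  next
    case False
    then have xy: "y \<in> A" "x \<in> B" "x \<notin> A" "(y, x) \<notin> X"
      using that assms(1) by (auto simp: orient_def)
    then have "X `` {y} \<subseteq> below x" by (auto simp: below_def)
    then have "card (X `` {y}) \<le> card (below x)" by (simp add: fin card_mono)
    then show ?thesis using xy by (simp add: rank_def)
  qed
  then have "orient A B X \<subseteq> (measure rank)\<inverse>" by auto
  moreover have "acyclic ((measure rank)\<inverse>)" by (simp add: acyclic_converse wf_acyclic)
  ultimately show "acyclic (orient A B X)" by (rule acyclic_subset[rotated])
qed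

lemma R_orientations_eq_image:
  "R_orientations m n = orient (left_part m) (right_part m n) ` chain_rels (left_part m) (right_part m n)"
proof -
  let ?A = "left_part m" and ?B = "right_part m n"
  have disj: "?A \<inter> ?B = {}" and fin: "finite ?A" "finite ?B"
    by (auto simp: left_part_def right_part_def)
  \<comment> \<open>The reversed arcs start in the right part, so the out-neighbours of u are given
    by \<open>X\<close> alone.\<close>
  have sink: "is_sink (orient ?A ?B X) u \<longleftrightarrow> X `` {u} = {}" if "u \<in> ?A" for X u
    using that disj by (auto simp: is_sink_def orient_def)
  show ?thesis
    unfolding R_orientations_def bipartite_edges_def is_orientation_iff_orient[OF disj] chain_rels_def
    by (auto simp: acyclic_orient_iff[OF disj fin] sink)
qed

lemma inj_on_orient: "A \<inter> B = {} \<Longrightarrow> inj_on (orient A B) (Pow (A \<times> B))"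
  by (rule inj_on_inverseI[where g = "\<lambda>D. D \<inter> A \<times> B"]) (auto simp: orient_def)

theorem theorem6p2:
  fixes m n :: nat
  assumes "n \<ge> 1"
  shows "int (card (R_orientations m n)) =
    fact n * int n ^ m
    - (\<Sum>j = 1..n - 1. (- 1) ^ (j - 1) * fact (n - j) * int (n - j) ^ m * int (Stirling n (n - j)))"
proof -
  let ?A = "left_part m" and ?B = "right_part m n"
  let ?t = "\<lambda>k. (- 1) ^ (n + k) * fact k * int (Stirling n k) * int k ^ m"
  have "inj_on (orient ?A ?B) (chain_rels ?A ?B)"
    by (rule inj_on_subset[OF inj_on_orient]) (auto simp: left_part_def right_part_def chain_rels_def)
  then have "int (card (R_orientations m n)) = int (card (chain_rels ?A ?B))"
    by (simp add: R_orientations_eq_image card_image)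
  also have "\<dots> = (\<Sum>k\<le>n. ?t k)"
    by (subst card_chain_rels) (simp_all add: left_part_def right_part_def iterated_diff_eq_sum_Stirling)
  also have "\<dots> = (\<Sum>k = 1..n. ?t k)"
  proof (rule sum.mono_neutral_right)
    \<comment> \<open>The term k = 0 vanishes since \<open>Stirling n 0 = 0\<close> for positive n;
      the power would not suffice, as 0^0 = 1.\<close>
    show "\<forall>k\<in>{..n} - {1..n}. ?t k = 0" using assms by (cases n) (auto simp: Suc_le_eq)
  qed auto
  \<comment> \<open>The term k = n is the leading term of the formula: its sign is even and
    \<open>Stirling n n = 1\<close>.\<close>
  also have "\<dots> = ?t n + (\<Sum>k = 1..n - 1. ?t k)"
    using assms by (cases n) simp_all
  also have "(\<Sum>k = 1..n - 1. ?t k) = (\<Sum>j = 1..n - 1. ?t (n - j))"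
    by (rule sum.reindex_bij_witness[of _ "\<lambda>j. n - j" "\<lambda>k. n - k"]) auto
  also have "\<dots> = (\<Sum>j = 1..n - 1. - ((- 1) ^ (j - 1) * fact (n - j) * int (n - j) ^ m * int (Stirling n (n - j))))"
  proof (rule sum.cong[OF refl])
    fix j assume j: "j \<in> {1..n - 1}"
    have "even (n + (n - j) + j)" using j by auto
    then have "(- 1) ^ (n + (n - j)) = ((- 1) ^ j :: int)" by (simp add: minus_one_power_iff)
    also have "\<dots> = - ((- 1) ^ (j - 1))" using j by (cases j) simp_all
    finally have "(- 1) ^ (n + (n - j)) = - ((- 1) ^ (j - 1) :: int)" .
    then show "?t (n - j) = - ((- 1) ^ (j - 1) * fact (n - j) * int (n - j) ^ m * int (Stirling n (n - j)))"
      by simp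
  qed
  finally show ?thesis by (simp add: sum_negf)
qed

end
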